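(* Let $G$ and $H$ be finitely generated free groups, and let $\psi:G\to H$ be a homomorphism. Then the set of homomorphisms \[ \{\phi:G\to H\mid \phi\text{ has remnant and } |\operatorname{Rem}_\phi a|>|\psi(a)|\text{ for every generator }a\in G\} \] is generic.
   Context: Fix free generators $a_1,\dots,a_n$ of $G$ and a free generating set of $H$; "generator of $G$" means one of $a_1,\dots,a_n$, and $|w|$ denotes reduced word length of a word $w$. A homomorphism $\phi:G\to H$ is identified with the $n$-tuple $(\phi(a_1),\dots,\phi(a_n))\in H^n$. For a natural number $p$, $H_p$ is the set of elements of $H$ of reduced word length at most $p$. The asymptotic density of $S\subset H^n$ is $D(S)=\lim_{p\to\infty}|S\cap(H_p)^n|/|(H_p)^n|$ (cardinalities), and $S$ is generic if $D(S)=1$. Remnant. Let $t=(h_1,\dots,h_n)$ be a tuple of reduced words in $H$. We say $t$ has remnant when, for each $i$, there is a nontrivial subword of $h_i$ which does not cancel in any product of the form $h_j^{\alpha_j}h_ih_k^{\beta_k}$, where $j,k\in\{1,\dots,n\}$, with $\alpha_r,\beta_r\in\{-1,0,1\}$ for $r\ne i$ and $\alpha_i,\beta_i\in\{0,1\}$. The (maximal) such noncancelling subword is the remnant of $h_i$. The homomorphism $\phi$ has remnant if $(\phi(a_1),\dots,\phi(a_n))$ has remnant, and $\operatorname{Rem}_\phi a_i$ denotes the remnant of $\phi(a_i)$.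
   Formalization: The formal theorem assumes that H has rank at least 2 or that the rank of G is at most the rank of H; in the excluded cases (H trivial with G nontrivial, or H infinite cyclic with G of rank at least 2) no homomorphism has remnant, so the claim is false there. *)

theory Defs
  imports "HOL-Analysis.Analysis" "HOL-Algebra.Algebra"
begin

(* A letter (x, True) stands for the generator x, and (x, False) for its inverse. *)
type_synonym 'a word = "('a \<times> bool) list"

definition inv_letter :: "'a \<times> bool \<Rightarrow> 'a \<times> bool" where
  "inv_letter l = (fst l, \<not> snd l)"

definition reduced_words :: "'a set \<Rightarrow> 'a word set" where
  "reduced_words S =
     {w. set w \<subseteq> S \<times> UNIV \<and> successively (\<lambda>l l'. l' \<noteq> inv_letter l) w}"

definition word_val :: "('a, 'm) monoid_scheme \<Rightarrow> 'a word \<Rightarrow> 'a" where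
  "word_val G w =
     foldr (\<lambda>(x, e) g. (if e then x else inv\<^bsub>G\<^esub> x) \<otimes>\<^bsub>G\<^esub> g) w \<one>\<^bsub>G\<^esub>"

(* G is free on S: every element is the value of exactly one reduced word over S. *)
definition free_basis :: "('a, 'm) monoid_scheme \<Rightarrow> 'a set \<Rightarrow> bool" where
  "free_basis G S \<longleftrightarrow>
     group G \<and> S \<subseteq> carrier G \<and> bij_betw (word_val G) (reduced_words S) (carrier G)"

definition reduced_word :: "('a, 'm) monoid_scheme \<Rightarrow> 'a set \<Rightarrow> 'a \<Rightarrow> 'a word" where
  "reduced_word G S g = the_inv_into (reduced_words S) (word_val G) g"

definition word_length :: "('a, 'm) monoid_scheme \<Rightarrow> 'a set \<Rightarrow> 'a \<Rightarrow> nat" where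
  "word_length G S g = length (reduced_word G S g)"

definition word_ball :: "('a, 'm) monoid_scheme \<Rightarrow> 'a set \<Rightarrow> nat \<Rightarrow> 'a set" where
  "word_ball G S p = {g \<in> carrier G. word_length G S g \<le> p}"

(* n-tuples are extensional functions on {..<n}. *)
definition has_asymp_density ::
    "('a, 'm) monoid_scheme \<Rightarrow> 'a set \<Rightarrow> nat \<Rightarrow> (nat \<Rightarrow> 'a) set \<Rightarrow> real \<Rightarrow> bool" where
  "has_asymp_density H Y n T d \<longleftrightarrow>
     (\<lambda>p. real (card (T \<inter> ({..<n} \<rightarrow>\<^sub>E word_ball H Y p)))
            / real (card ({..<n} \<rightarrow>\<^sub>E word_ball H Y p))) \<longlonglongrightarrow> d"

definition generic ::
    "('a, 'm) monoid_scheme \<Rightarrow> 'a set \<Rightarrow> nat \<Rightarrow> (nat \<Rightarrow> 'a) set \<Rightarrow> bool" where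
  "generic H Y n T \<longleftrightarrow> has_asymp_density H Y n T 1"

definition remnant_exponents :: "nat \<Rightarrow> nat \<Rightarrow> int set" where
  "remnant_exponents i r = (if r = i then {0, 1} else {-1, 0, 1})"

(* The occurrence of v in the word u @ v @ w does not cancel in the product of x, this word and y:
   the reduced form of the product arises by reducing the parts to the left and to the right of v
   separately, with v left intact between them. *)
definition does_not_cancel ::
    "('a, 'm) monoid_scheme \<Rightarrow> 'a set \<Rightarrow> 'a \<Rightarrow> 'a word \<Rightarrow> 'a word \<Rightarrow> 'a word \<Rightarrow> 'a \<Rightarrow> bool" where
  "does_not_cancel H Y x u v w y \<longleftrightarrow>
     reduced_word H Y (x \<otimes>\<^bsub>H\<^esub> word_val H (u @ v @ w) \<otimes>\<^bsub>H\<^esub> y) =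
       reduced_word H Y (x \<otimes>\<^bsub>H\<^esub> word_val H u) @ v @ reduced_word H Y (word_val H w \<otimes>\<^bsub>H\<^esub> y)"

definition noncancelling_subword ::
    "('a, 'm) monoid_scheme \<Rightarrow> 'a set \<Rightarrow> nat \<Rightarrow> (nat \<Rightarrow> 'a) \<Rightarrow> nat \<Rightarrow> 'a word \<Rightarrow> bool" where
  "noncancelling_subword H Y n h i v \<longleftrightarrow>
     v \<noteq> [] \<and>
     (\<exists>u w. reduced_word H Y (h i) = u @ v @ w \<and>
        (\<forall>j<n. \<forall>k<n. \<forall>\<alpha>\<in>remnant_exponents i j. \<forall>\<beta>\<in>remnant_exponents i k.
           does_not_cancel H Y (h j [^]\<^bsub>H\<^esub> \<alpha>) u v w (h k [^]\<^bsub>H\<^esub> \<beta>)))"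

definition has_remnant ::
    "('a, 'm) monoid_scheme \<Rightarrow> 'a set \<Rightarrow> nat \<Rightarrow> (nat \<Rightarrow> 'a) \<Rightarrow> bool" where
  "has_remnant H Y n h \<longleftrightarrow> (\<forall>i<n. \<exists>v. noncancelling_subword H Y n h i v)"

(* Meaningful only for tuples with remnant. *)
definition remnant ::
    "('a, 'm) monoid_scheme \<Rightarrow> 'a set \<Rightarrow> nat \<Rightarrow> (nat \<Rightarrow> 'a) \<Rightarrow> nat \<Rightarrow> 'a word" where
  "remnant H Y n h i = arg_max length (noncancelling_subword H Y n h i)"

definition hom_tuple :: "nat \<Rightarrow> (nat \<Rightarrow> 'a) \<Rightarrow> ('a \<Rightarrow> 'b) \<Rightarrow> nat \<Rightarrow> 'b" where
  "hom_tuple n a \<phi> = (\<lambda>i\<in>{..<n}. \<phi> (a i))"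

end

theory Submission imports Defs "HOL-Library.Sublist" begin

text \<open>
  Suppose that every h_i has length greater than 2m + c and that the 2n words h_i, h_i^{-1} have
  pairwise distinct prefixes of length m.  Then a factor h_j^{\<plusminus>1} cancels fewer than m letters of a
  neighbouring h_i, so removing m letters from both ends of h_i leaves a noncancelling subword of
  length greater than c.  With r = 2 |Y| - 1 there are between r^l and 2 r^l reduced words of length l,
  so a random word of the ball starts or ends in a prescribed way with probability at most r^{-m};
  the tuples violating the condition therefore have upper density O(r^{-m}), and m is arbitrary.
  If |Y| = 1 this gives nothing, but then n \<le> 1 and, with m = 1, coincidences are impossible.
\<close>

subsection \<open>Words and free groups\<close>

definition inverse_word :: "'a word \<Rightarrow> 'a word" where
  "inverse_word w = rev (map inv_letter w)"

lemma inv_letter_inv_letter [simp]: "inv_letter (inv_letter l) = l"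
  by (simp add: inv_letter_def)

lemma inv_letter_eq_iff [simp]: "inv_letter l = inv_letter l' \<longleftrightarrow> l = l'"
  by (metis inv_letter_inv_letter)

lemma inv_letter_mem_iff [simp]: "inv_letter l \<in> S \<times> UNIV \<longleftrightarrow> l \<in> S \<times> UNIV"
  by (cases l) (simp add: inv_letter_def)

lemma inverse_word_inverse_word [simp]: "inverse_word (inverse_word w) = w"
  by (simp add: inverse_word_def rev_map comp_def)

lemma length_inverse_word [simp]: "length (inverse_word w) = length w"
  by (simp add: inverse_word_def)

lemma inverse_word_append [simp]: "inverse_word (u @ v) = inverse_word v @ inverse_word u"
  by (simp add: inverse_word_def)

lemma inverse_word_Nil_iff [simp]: "inverse_word w = [] \<longleftrightarrow> w = []"
  by (simp add: inverse_word_def)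

lemma hd_inverse_word: "w \<noteq> [] \<Longrightarrow> hd (inverse_word w) = inv_letter (last w)"
  by (simp add: inverse_word_def hd_rev last_map)

lemma last_inverse_word: "w \<noteq> [] \<Longrightarrow> last (inverse_word w) = inv_letter (hd w)"
  by (simp add: inverse_word_def last_rev hd_map)

lemma Nil_in_reduced_words [simp]: "[] \<in> reduced_words S"
  by (simp add: reduced_words_def)

lemma reduced_words_append_iff:
  "u @ v \<in> reduced_words S \<longleftrightarrow> u \<in> reduced_words S \<and> v \<in> reduced_words S \<and>
     (u = [] \<or> v = [] \<or> hd v \<noteq> inv_letter (last u))"
  by (auto simp: reduced_words_def successively_append_iff)

lemma inverse_word_in_reduced_words:
  assumes "w \<in> reduced_words S"
  shows "inverse_word w \<in> reduced_words S"
proof -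
  \<comment> \<open>Reversal swaps the two arguments of the adjacency condition, which is symmetric
    because \<open>inv_letter\<close> is an involution.\<close>
  have eq: "(\<lambda>l l'. l \<noteq> inv_letter l') = (\<lambda>l l' :: 'a \<times> bool. l' \<noteq> inv_letter l)"
    by (intro ext) (metis inv_letter_inv_letter)
  have "successively (\<lambda>l l'. l \<noteq> inv_letter l') w"
    unfolding eq using assms by (simp add: reduced_words_def)
  moreover have "set (inverse_word w) \<subseteq> S \<times> UNIV"
    using assms by (auto simp: reduced_words_def inverse_word_def inv_letter_def)
  ultimately show ?thesis
    by (simp add: reduced_words_def inverse_word_def successively_map)
qed

section \<open>Free reduction and evaluation of words\<close>

fun cons_reduce :: "'a \<times> bool \<Rightarrow> 'a word \<Rightarrow> 'a word" where
  "cons_reduce l [] = [l]"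
| "cons_reduce l (k # w) = (if k = inv_letter l then w else l # k # w)"

text \<open>A letter put in front of a reduced word can cancel only against the first letter, so one
  pass from the right end yields the reduced form.\<close>

definition reduce :: "'a word \<Rightarrow> 'a word" where
  "reduce w = foldr cons_reduce w []"

lemma reduce_in_reduced_words: "set w \<subseteq> S \<times> UNIV \<Longrightarrow> reduce w \<in> reduced_words S"
proof (induction w)
  case (Cons l w)
  then show ?case
    by (cases "reduce w"; cases "tl (reduce w)") (auto simp: reduce_def reduced_words_def)
qed (simp add: reduce_def)

context group
begin

lemma word_val_Nil [simp]: "word_val G [] = \<one>"
  by (simp add: word_val_def)

lemma word_val_Cons:
  "word_val G (l # w) = (if snd l then fst l else inv (fst l)) \<otimes> word_val G w"
  by (simp add: word_val_def case_prod_beta)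

lemma word_val_closed [simp]: "set w \<subseteq> carrier G \<times> UNIV \<Longrightarrow> word_val G w \<in> carrier G"
  by (induction w) (auto simp: word_val_Cons)

lemma word_val_append:
  "set u \<subseteq> carrier G \<times> UNIV \<Longrightarrow> set v \<subseteq> carrier G \<times> UNIV \<Longrightarrow>
    word_val G (u @ v) = word_val G u \<otimes> word_val G v"
  by (induction u) (auto simp: word_val_Cons m_assoc)

lemma word_val_inverse_word:
  "set w \<subseteq> carrier G \<times> UNIV \<Longrightarrow> word_val G (inverse_word w) = inv (word_val G w)"
proof (induction w)
  case (Cons l w)
  have "set (inverse_word w) \<subseteq> carrier G \<times> UNIV"
    using Cons.prems by (auto simp: inverse_word_def inv_letter_def)
  moreover have "inverse_word (l # w) = inverse_word w @ [inv_letter l]"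
    by (simp add: inverse_word_def)
  ultimately show ?case
    using Cons by (auto simp: word_val_append word_val_Cons inv_letter_def inv_mult_group)
qed (simp add: inverse_word_def)

text \<open>Cancelling a letter against its inverse leaves the value unchanged under any assignment
  \<open>f\<close> of the generators. The identity as \<open>f\<close> shows that reduction keeps
  the group element; a general \<open>f\<close> serves to extend a map on a basis to a
  homomorphism.\<close>

lemma word_val_map_reduce:
  assumes "f \<in> S \<rightarrow> carrier G" "set w \<subseteq> S \<times> UNIV"
  shows "word_val G (map (apfst f) (reduce w)) = word_val G (map (apfst f) w)"
  using assms(2)
proof (induction w)
  case (Cons l w)
  have closed: "set (map (apfst f) (reduce w)) \<subseteq> carrier G \<times> UNIV"
    using reduce_in_reduced_words[of w S] Cons.prems assms(1)
    by (fastforce simp: reduced_words_def)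
  have l: "f (fst l) \<in> carrier G"
    using Cons.prems assms(1) by auto
  have "word_val G (map (apfst f) (cons_reduce l (reduce w)))
      = word_val G (map (apfst f) (l # reduce w))"
    using closed l
    by (cases "reduce w") (auto simp: word_val_Cons inv_letter_def m_assoc[symmetric])
  then show ?case
    using Cons by (simp add: reduce_def word_val_Cons)
qed (simp add: reduce_def)

end

section \<open>Reduced forms and the universal property of free groups\<close>

lemma
  assumes "free_basis G S" and "g \<in> carrier G"
  shows reduced_word_in_reduced_words: "reduced_word G S g \<in> reduced_words S"
    and word_val_reduced_word: "word_val G (reduced_word G S g) = g"
  using assms unfolding reduced_word_def free_basis_def
  by (auto simp: bij_betw_def the_inv_into_into f_the_inv_into_f)

lemma reduced_word_word_val:
  "free_basis G S \<Longrightarrow> w \<in> reduced_words S \<Longrightarrow> reduced_word G S (word_val G w) = w"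
  unfolding reduced_word_def free_basis_def by (auto simp: bij_betw_def the_inv_into_f_f)

lemma set_reduced_word_subset:
  "free_basis G S \<Longrightarrow> w \<in> reduced_words S \<Longrightarrow> set w \<subseteq> carrier G \<times> UNIV"
  by (fastforce simp: free_basis_def reduced_words_def)

lemma word_val_in_carrier:
  assumes "free_basis G S" and "w \<in> reduced_words S"
  shows "word_val G w \<in> carrier G"
  using assms bij_betwE by (auto simp: free_basis_def)

text \<open>The map substitutes \<open>f\<close> into the reduced word of an element. Since
  reduction does not affect values after substitution, a product may be evaluated on the unreduced
  concatenation, which gives multiplicativity. Through this lemma every tuple in H^n comes from a
  homomorphism.\<close>

lemma free_basis_hom_exists:
  assumes "free_basis G S" and "group H" and f: "f \<in> S \<rightarrow> carrier H"
  obtains \<phi> where "\<phi> \<in> hom G H" "\<And>x. x \<in> S \<Longrightarrow> \<phi> x = f x"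
proof -
  interpret G: group G using assms by (simp add: free_basis_def)
  interpret H: group H by fact
  have S: "S \<subseteq> carrier G" using assms by (simp add: free_basis_def)
  let ?rw = "reduced_word G S"
  note rw = reduced_word_in_reduced_words[OF assms(1)] word_val_reduced_word[OF assms(1)]
  \<comment> \<open>Uniqueness of reduced words identifies \<open>reduce w\<close> with the normal
    form; the value is preserved by the case \<open>f = id\<close>.\<close>
  have rw_word: "?rw (word_val G w) = reduce w" if "set w \<subseteq> S \<times> UNIV" for w
  proof -
    have "map (apfst id) w = w" for w :: "'a word"
      by (simp add: apfst_def map_prod.id)
    moreover have "id \<in> S \<rightarrow> carrier G"
      using S by auto
    ultimately have "word_val G (reduce w) = word_val G w"
      using G.word_val_map_reduce[of id S w] that by simp
    then show ?thesis
      using reduced_word_word_val[OF assms(1)] reduce_in_reduced_words[OF that] by metis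
  qed
  define \<phi> where "\<phi> g = word_val H (map (apfst f) (?rw g))" for g
  have \<phi>_word: "\<phi> (word_val G w) = word_val H (map (apfst f) w)" if "set w \<subseteq> S \<times> UNIV" for w
    using that f by (simp add: \<phi>_def rw_word H.word_val_map_reduce)
  have closed: "set (map (apfst f) w) \<subseteq> carrier H \<times> UNIV" if "w \<in> reduced_words S" for w
    using that f by (fastforce simp: reduced_words_def)
  have "\<phi> \<in> hom G H"
  proof (rule homI)
    show "\<phi> g \<in> carrier H" if "g \<in> carrier G" for g
      using closed rw that by (simp add: \<phi>_def)
    show "\<phi> (g \<otimes>\<^bsub>G\<^esub> h) = \<phi> g \<otimes>\<^bsub>H\<^esub> \<phi> h" if gh: "g \<in> carrier G" "h \<in> carrier G" for g h
    proof -
      have set: "set (?rw g) \<subseteq> S \<times> UNIV" "set (?rw h) \<subseteq> S \<times> UNIV"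
        using rw gh by (auto simp: reduced_words_def)
      then have "g \<otimes>\<^bsub>G\<^esub> h = word_val G (?rw g @ ?rw h)"
        using rw gh S by (subst G.word_val_append) auto
      then have "\<phi> (g \<otimes>\<^bsub>G\<^esub> h) = word_val H (map (apfst f) (?rw g) @ map (apfst f) (?rw h))"
        using set by (simp add: \<phi>_word)
      then show ?thesis
        using closed rw gh by (simp add: H.word_val_append \<phi>_def)
    qed
  qed
  moreover have "\<phi> x = f x" if "x \<in> S" for x
  proof -
    have "word_val G [(x, True)] = x"
      using that S by (auto simp: G.word_val_Cons)
    then show ?thesis
      using \<phi>_word[of "[(x, True)]"] that f H.r_one[of "f x"] by (auto simp: H.word_val_Cons Pi_iff)
  qed
  ultimately show thesis by (rule that)
qed

subsection \<open>Noncancelling subwords\<close>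

text \<open>The cancelled part \<open>q\<close> is the longest common prefix of \<open>u\<close> and
  \<open>inverse_word x\<close>: by maximality the letters that follow it differ, so cancellation
  stops there. The prefix hypothesis says that \<open>x\<close> does not consume all of
  \<open>u\<close>, hence \<open>r\<close> is nonempty.\<close>

lemma reduced_words_cancel_left:
  assumes "x \<in> reduced_words S" "u \<in> reduced_words S" "\<not> prefix u (inverse_word x)"
  obtains p q r where "x = p @ inverse_word q" "u = q @ r" "r \<noteq> []" "p @ r \<in> reduced_words S"
proof -
  define q where "q = longest_common_prefix u (inverse_word x)"
  obtain r p' where r: "u = q @ r" and p': "inverse_word x = q @ p'"
    by (metis longest_common_prefix_prefix1 longest_common_prefix_prefix2 prefixE q_def)
  have "r \<noteq> []"
    using assms(3) r p' by (auto simp: prefix_def)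
  have x: "x = inverse_word p' @ inverse_word q"
    by (metis inverse_word_append inverse_word_inverse_word p')
  have "p' = [] \<or> hd p' \<noteq> hd r"
  proof (rule ccontr)
    assume "\<not> (p' = [] \<or> hd p' \<noteq> hd r)"
    then have "prefix (q @ [hd r]) u" "prefix (q @ [hd r]) (inverse_word x)"
      using r p' \<open>r \<noteq> []\<close> by (metis (no_types) Cons_prefix_Cons list.collapse Nil_prefix same_prefix_prefix)+
    then have "prefix (q @ [hd r]) q"
      unfolding q_def by (rule longest_common_prefix_max_prefix)
    then show False
      using prefix_length_le by fastforce
  qed
  then have "inverse_word p' @ r \<in> reduced_words S"
    using assms(1,2) unfolding x r by (auto simp: reduced_words_append_iff last_inverse_word)
  then show thesis
    using that x r \<open>r \<noteq> []\<close> by blast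
qed

text \<open>Inverting all words turns this into cancellation on the left.\<close>

lemma reduced_words_cancel_right:
  assumes "w \<in> reduced_words S" "y \<in> reduced_words S" "\<not> prefix (inverse_word w) y"
  obtains p q r where "y = inverse_word q @ p" "w = r @ q" "r \<noteq> []" "r @ p \<in> reduced_words S"
proof -
  have "\<not> prefix (inverse_word w) (inverse_word (inverse_word y))"
    using assms by simp
  then obtain p q r where *: "inverse_word y = p @ inverse_word q" "inverse_word w = q @ r"
      "r \<noteq> []" "p @ r \<in> reduced_words S"
    using assms by (meson inverse_word_in_reduced_words reduced_words_cancel_left)
  show thesis
  proof (rule that)
    show "y = inverse_word (inverse_word q) @ inverse_word p"
      by (metis * inverse_word_append inverse_word_inverse_word)
    show "w = inverse_word r @ inverse_word q"
      by (metis * inverse_word_append inverse_word_inverse_word)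
    show "inverse_word r @ inverse_word p \<in> reduced_words S"
      by (metis * inverse_word_append inverse_word_in_reduced_words)
  qed (use * in simp)
qed

text \<open>Cancellation with \<open>x\<close> stops inside \<open>u\<close> and cancellation with
  \<open>y\<close> stops inside \<open>w\<close>, so nonempty rests \<open>r\<close> and
  \<open>r'\<close> still border on \<open>v\<close>. Being reduced is a condition on adjacent
  letters, hence the surviving parts join to a reduced word, and uniqueness of reduced words
  finishes.\<close>

lemma does_not_cancelI:
  assumes free: "free_basis H Y"
    and x: "x \<in> reduced_words Y" and y: "y \<in> reduced_words Y"
    and uvw: "u @ v @ w \<in> reduced_words Y" and "v \<noteq> []"
    and "\<not> prefix u (inverse_word x)" and "\<not> prefix (inverse_word w) y"
  shows "does_not_cancel H Y (word_val H x) u v w (word_val H y)"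
proof -
  interpret H: group H using free by (simp add: free_basis_def)
  have u: "u \<in> reduced_words Y" and v: "v \<in> reduced_words Y" and w: "w \<in> reduced_words Y"
    using uvw by (auto simp: reduced_words_append_iff)
  note mem = set_reduced_word_subset[OF free]
  obtain p q r where l: "x = p @ inverse_word q" "u = q @ r" "r \<noteq> []" "p @ r \<in> reduced_words Y"
    using assms u by (meson reduced_words_cancel_left)
  obtain p' q' r' where
    r: "y = inverse_word q' @ p'" "w = r' @ q'" "r' \<noteq> []" "r' @ p' \<in> reduced_words Y"
    using assms w by (meson reduced_words_cancel_right)
  have sets: "set p \<subseteq> carrier H \<times> UNIV" "set q \<subseteq> carrier H \<times> UNIV" "set r \<subseteq> carrier H \<times> UNIV"
      "set p' \<subseteq> carrier H \<times> UNIV" "set q' \<subseteq> carrier H \<times> UNIV" "set r' \<subseteq> carrier H \<times> UNIV"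
      "set (inverse_word q) \<subseteq> carrier H \<times> UNIV" "set (inverse_word q') \<subseteq> carrier H \<times> UNIV"
    using mem[OF x] mem[OF u] mem[OF w] mem[OF y] unfolding l(1,2) r(1,2) by simp_all
  have v': "set v \<subseteq> carrier H \<times> UNIV" using mem[OF v] .
  have cancel: "a \<otimes>\<^bsub>H\<^esub> (inv\<^bsub>H\<^esub> a \<otimes>\<^bsub>H\<^esub> b) = b" "inv\<^bsub>H\<^esub> a \<otimes>\<^bsub>H\<^esub> (a \<otimes>\<^bsub>H\<^esub> b) = b"
    if "a \<in> carrier H" "b \<in> carrier H" for a b
    using that by (simp_all add: H.m_assoc[symmetric])
  have xu: "word_val H x \<otimes>\<^bsub>H\<^esub> word_val H u = word_val H (p @ r)"
    unfolding l(1,2) using sets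
    by (simp add: H.word_val_append H.word_val_inverse_word H.m_assoc cancel)
  have wy: "word_val H w \<otimes>\<^bsub>H\<^esub> word_val H y = word_val H (r' @ p')"
    unfolding r(1,2) using sets
    by (simp add: H.word_val_append H.word_val_inverse_word H.m_assoc cancel)
  have red: "(p @ r) @ v @ (r' @ p') \<in> reduced_words Y"
    using uvw l(3,4) r(3,4) \<open>v \<noteq> []\<close> unfolding l(2) r(2)
    by (auto simp: reduced_words_append_iff)
  have "word_val H x \<otimes>\<^bsub>H\<^esub> word_val H (u @ v @ w) \<otimes>\<^bsub>H\<^esub> word_val H y
      = (word_val H x \<otimes>\<^bsub>H\<^esub> word_val H u) \<otimes>\<^bsub>H\<^esub> word_val H v \<otimes>\<^bsub>H\<^esub> (word_val H w \<otimes>\<^bsub>H\<^esub> word_val H y)"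
    using mem[OF u] mem[OF w] mem[OF x] mem[OF y] v' by (simp add: H.word_val_append H.m_assoc)
  also have "\<dots> = word_val H ((p @ r) @ v @ (r' @ p'))"
    unfolding xu wy using sets v' by (simp add: H.word_val_append H.m_assoc)
  finally show ?thesis
    unfolding does_not_cancel_def xu wy
    by (simp only: reduced_word_word_val[OF free] red l(4) r(4))
qed

text \<open>A prefix of the inverse is the inverse of a final segment. Both ends of \<open>w\<close>
  are thus recorded in a form in which cancellation between two words becomes a coincidence of
  prefixes.\<close>

definition end_prefixes :: "nat \<Rightarrow> 'a word \<Rightarrow> 'a word set" where
  "end_prefixes m w = {take m w, take m (inverse_word w)}"

text \<open>The subword is what is left of \<open>h i\<close> without its first and last
  \<open>m\<close> letters. A neighbouring factor \<open>h i\<close> reaches it only if the two ends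
  of \<open>h i\<close> match, which \<open>self\<close> excludes; \<open>cross\<close> deals with
  the other factors and their inverses. The inverse of \<open>h i\<close>, which would cancel
  everything, is not an admissible factor.\<close>

lemma noncancelling_subword_middle:
  fixes H :: "('b, 'd) monoid_scheme" and Y
  defines "rw \<equiv> reduced_word H Y"
  assumes free: "free_basis H Y" and h: "h \<in> {..<n} \<rightarrow> carrier H"
    and "i < n" and "0 < m" and len: "2 * m < length (rw (h i))"
    and self: "\<And>j. j < n \<Longrightarrow> take m (rw (h j)) \<noteq> take m (inverse_word (rw (h j)))"
    and cross: "\<And>j. j < n \<Longrightarrow> j \<noteq> i \<Longrightarrow>
      end_prefixes m (rw (h i)) \<inter> end_prefixes m (rw (h j)) = {}"
  obtains v where "noncancelling_subword H Y n h i v" "length v = length (rw (h i)) - 2 * m"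
proof -
  interpret H: group H using free by (simp add: free_basis_def)
  define z where "z = rw (h i)"
  define u where "u = take m z"
  define v where "v = take (length z - 2 * m) (drop m z)"
  define w where "w = drop (length z - 2 * m) (drop m z)"
  have z: "z = u @ v @ w"
    by (simp only: u_def v_def w_def append_take_drop_id)
  have carrier: "h j \<in> carrier H" if "j < n" for j
    using h that by auto
  have red: "rw (h j) \<in> reduced_words Y" and val: "word_val H (rw (h j)) = h j" if "j < n" for j
    using reduced_word_in_reduced_words[OF free] word_val_reduced_word[OF free] carrier[OF that]
    by (simp_all add: rw_def)
  have lenv: "length v = length z - 2 * m" "length w = m" "length u = m"
    using len by (auto simp: u_def v_def w_def z_def)
  then have "v \<noteq> []"
    using len by (auto simp: z_def)
  have w: "inverse_word w = take m (inverse_word z)"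
    using lenv by (simp add: z)
  have not_prefix: "\<not> prefix s t" if "take m t \<noteq> s" "length s = m" for s t :: "'b word"
    using that by (auto simp: prefix_def)
  \<comment> \<open>A factor may stand on either side of \<open>h i\<close>, so both prefix
    conditions are proved for the same word \<open>x\<close>.\<close>
  have powers: "\<exists>x \<in> reduced_words Y. h j [^]\<^bsub>H\<^esub> \<alpha> = word_val H x \<and>
      \<not> prefix u (inverse_word x) \<and> \<not> prefix (inverse_word w) x"
    if "j < n" and \<alpha>: "\<alpha> \<in> remnant_exponents i j" for j \<alpha>
  proof -
    have ends: "take m (inverse_word (rw (h j))) \<noteq> u" "take m (rw (h j)) \<noteq> inverse_word w"
      using self[OF \<open>j < n\<close>] cross[OF \<open>j < n\<close>] unfolding u_def w z_def end_prefixes_def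
      by (cases "j = i"; force)+
    consider "\<alpha> = 0" | "\<alpha> = 1" | "\<alpha> = -1" "j \<noteq> i"
      using \<alpha> by (auto simp: remnant_exponents_def split: if_splits)
    then show ?thesis
    proof cases
      \<comment> \<open>The factor is the empty word. Here \<open>0 < m\<close> matters: an empty
        \<open>u\<close> or \<open>w\<close> would count as fully cancelled.\<close>
      case 1
      have "u \<noteq> []" "w \<noteq> []"
        using lenv \<open>0 < m\<close> by auto
      then show ?thesis
        using 1 by (intro bexI[of _ "[]"]) (auto simp: inverse_word_def)
    next
      case 2
      then show ?thesis
        using ends carrier red val that
        by (intro bexI[of _ "rw (h j)"]) (simp_all add: not_prefix lenv H.int_pow_1)
    next
      case 3
      have "take m (rw (h j)) \<noteq> u" "take m (inverse_word (rw (h j))) \<noteq> inverse_word w"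
        using cross[OF \<open>j < n\<close>] 3 unfolding u_def w z_def end_prefixes_def by force+
      then show ?thesis
        using 3 carrier red val that set_reduced_word_subset[OF free red[OF \<open>j < n\<close>]]
        by (intro bexI[of _ "inverse_word (rw (h j))"])
          (simp_all add: not_prefix lenv inverse_word_in_reduced_words H.int_pow_neg
            H.int_pow_1 H.word_val_inverse_word)
    qed
  qed
  have "does_not_cancel H Y (h j [^]\<^bsub>H\<^esub> \<alpha>) u v w (h k [^]\<^bsub>H\<^esub> \<beta>)"
    if "j < n" "k < n" "\<alpha> \<in> remnant_exponents i j" "\<beta> \<in> remnant_exponents i k" for j k \<alpha> \<beta>
  proof -
    have "u @ v @ w \<in> reduced_words Y"
      using red[OF \<open>i < n\<close>] z by (simp add: z_def)
    then show ?thesis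
      using powers[OF that(1,3)] powers[OF that(2,4)] \<open>v \<noteq> []\<close> does_not_cancelI[OF free]
      by metis
  qed
  then have "noncancelling_subword H Y n h i v"
    using \<open>v \<noteq> []\<close> z unfolding noncancelling_subword_def z_def rw_def by blast
  then show thesis
    using that lenv by (simp add: z_def)
qed

lemma noncancelling_subword_length_le:
  "noncancelling_subword H Y n h i v \<Longrightarrow> length v \<le> word_length H Y (h i)"
  by (auto simp: noncancelling_subword_def word_length_def)

text \<open>The maximum behind \<open>arg_max\<close> is attained because all candidates are
  subwords of the reduced word of \<open>h i\<close>; the successor of its length is the strict
  bound that the library rule asks for.\<close>

lemma noncancelling_subword_length_le_remnant:
  assumes "noncancelling_subword H Y n h i v"
  shows "length v \<le> length (remnant H Y n h i)"
  unfolding remnant_def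
  by (rule arg_max_nat_le[where P = "noncancelling_subword H Y n h i", OF assms,
        of _ "Suc (word_length H Y (h i))"])
    (auto dest: noncancelling_subword_length_le)

subsection \<open>Counting reduced words\<close>

definition words_of_length :: "'a set \<Rightarrow> nat \<Rightarrow> 'a word set" where
  "words_of_length S l = {w \<in> reduced_words S. length w = l}"

definition words_up_to :: "'a set \<Rightarrow> nat \<Rightarrow> 'a word set" where
  "words_up_to S p = {w \<in> reduced_words S. length w \<le> p}"

lemma finite_words_up_to: "finite S \<Longrightarrow> finite (words_up_to S p)"
  by (rule finite_subset[OF _ finite_lists_length_le[of "S \<times> UNIV" p]])
    (auto simp: words_up_to_def reduced_words_def)

lemma finite_words_of_length: "finite S \<Longrightarrow> finite (words_of_length S l)"
  by (rule finite_subset[OF _ finite_words_up_to[of S l]])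
    (auto simp: words_of_length_def words_up_to_def)

lemma inverse_word_in_words_of_length:
  "w \<in> words_of_length S l \<Longrightarrow> inverse_word w \<in> words_of_length S l"
  by (auto simp: words_of_length_def inverse_word_in_reduced_words)

lemma singleton_in_reduced_words [simp]: "[k] \<in> reduced_words S \<longleftrightarrow> k \<in> S \<times> UNIV"
  by (auto simp: reduced_words_def)

text \<open>A reduced word is extended by any letter except the inverse of its last one, and
  \<open>0 < l\<close> ensures that a last letter exists. With the predicates \<open>P\<close> and
  \<open>Q\<close>, the same recursion counts all words and the words with a given prefix.\<close>

lemma card_words_of_length_Suc:
  assumes "finite S" "0 < l" and Q: "\<And>w k. length w = l \<Longrightarrow> P (w @ [k]) \<longleftrightarrow> Q w"
  shows "card {w \<in> words_of_length S (Suc l). P w}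
    = (2 * card S - 1) * card {w \<in> words_of_length S l. Q w}"
proof -
  let ?A = "{w \<in> words_of_length S l. Q w}"
  let ?E = "\<lambda>w. S \<times> UNIV - {inv_letter (last w)}"
  have "{w \<in> words_of_length S (Suc l). P w} = (\<lambda>(w, k). w @ [k]) ` (SIGMA w:?A. ?E w)"
  proof (intro equalityI subsetI)
    fix w assume "w \<in> {w \<in> words_of_length S (Suc l). P w}"
    then have w: "w \<in> reduced_words S" "length w = Suc l" "P w"
      by (auto simp: words_of_length_def)
    then obtain v k where v: "w = v @ [k]"
      by (metis length_0_conv nat.distinct(1) rev_exhaust)
    then have "(v, k) \<in> (SIGMA w:?A. ?E w)"
      using w Q[of v k] \<open>0 < l\<close> by (auto simp: reduced_words_append_iff words_of_length_def)
    then show "w \<in> (\<lambda>(w, k). w @ [k]) ` (SIGMA w:?A. ?E w)"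
      using v by force
  next
    fix w assume "w \<in> (\<lambda>(w, k). w @ [k]) ` (SIGMA w:?A. ?E w)"
    then show "w \<in> {w \<in> words_of_length S (Suc l). P w}"
      using Q by (auto simp: words_of_length_def reduced_words_append_iff)
  qed
  moreover have "inj_on (\<lambda>(w, k). w @ [k]) (SIGMA w:?A. ?E w)"
    by (auto simp: inj_on_def)
  moreover have "card (SIGMA w:?A. ?E w) = (\<Sum>w\<in>?A. card (?E w))"
    using assms(1) by (intro card_SigmaI) (auto simp: finite_words_of_length)
  moreover have "card (?E w) = 2 * card S - 1" if "w \<in> ?A" for w
  proof -
    have "last w \<in> S \<times> UNIV"
      using that \<open>0 < l\<close> last_in_set[of w] by (auto simp: words_of_length_def reduced_words_def)
    then show ?thesis
      using assms(1) by (subst card_Diff_singleton) (auto simp: card_cartesian_product mult.commute)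
  qed
  ultimately show ?thesis
    by (simp add: card_image)
qed

section \<open>Growth of the number of reduced words and frequency of given ends\<close>

lemma words_of_length_0: "words_of_length S 0 = {[]}"
  by (auto simp: words_of_length_def)

lemma card_words_of_length_1:
  assumes "finite S"
  shows "card (words_of_length S (Suc 0)) = 2 * card S"
proof -
  have "words_of_length S (Suc 0) = (\<lambda>k. [k]) ` (S \<times> UNIV)"
    by (auto simp: words_of_length_def reduced_words_def length_Suc_conv)
  then show ?thesis
    by (simp add: card_image inj_on_def card_cartesian_product)
qed

lemma card_words_of_length:
  assumes "finite S"
  shows "card (words_of_length S (Suc l)) = 2 * card S * (2 * card S - 1) ^ l"
proof (induction l)
  case (Suc l)
  then show ?case
    using card_words_of_length_Suc[OF assms, of "Suc l" "\<lambda>_. True" "\<lambda>_. True"] by simp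
qed (simp add: card_words_of_length_1 assms)

text \<open>In the exact count for positive length one factor is \<open>2 * card S\<close> instead
  of \<open>2 * card S - 1\<close>. Since \<open>S\<close> is nonempty, the former lies between the
  latter and its double.\<close>

lemma
  assumes "finite S" "S \<noteq> {}"
  shows card_words_of_length_ge: "(2 * card S - 1) ^ l \<le> card (words_of_length S l)"
    and card_words_of_length_le: "card (words_of_length S l) \<le> 2 * (2 * card S - 1) ^ l"
proof -
  obtain r where r: "card S = Suc r"
    using assms by (metis card_eq_0_iff not0_implies_Suc)
  have "(2 * card S - 1) ^ l \<le> card (words_of_length S l) \<and>
      card (words_of_length S l) \<le> 2 * (2 * card S - 1) ^ l"
  proof (cases l)
    case (Suc k)
    then show ?thesis
      by (simp add: card_words_of_length[OF assms(1)] r del: mult_Suc)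
  qed (simp add: words_of_length_0)
  then show "(2 * card S - 1) ^ l \<le> card (words_of_length S l)"
    "card (words_of_length S l) \<le> 2 * (2 * card S - 1) ^ l" by auto
qed

text \<open>Once the prefix is fixed, each of the remaining \<open>l - m\<close> letters can be
  chosen in \<open>2 * card S - 1\<close> ways. Multiplying by the power instead of dividing keeps
  the estimate within the naturals.\<close>

lemma card_words_with_prefix:
  assumes "finite S" "S \<noteq> {}" "0 < m" "m \<le> l"
  shows "card {w \<in> words_of_length S l. take m w = s} * (2 * card S - 1) ^ m
    \<le> card (words_of_length S l)"
proof -
  let ?r = "2 * card S - 1"
  have "card {w \<in> words_of_length S l. take m w = s} * ?r ^ m \<le> ?r ^ l"
    using \<open>m \<le> l\<close>
  proof (induction l rule: dec_induct)
    case base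
    have "{w \<in> words_of_length S m. take m w = s} \<subseteq> {s}"
      by (auto simp: words_of_length_def)
    then have "card {w \<in> words_of_length S m. take m w = s} \<le> 1"
      by (metis card_mono finite.emptyI finite_insert is_singletonI is_singleton_altdef)
    then show ?case by simp
  next
    case (step l)
    have "card {w \<in> words_of_length S (Suc l). take m w = s}
        = ?r * card {w \<in> words_of_length S l. take m w = s}"
      using assms step.hyps by (intro card_words_of_length_Suc) auto
    then show ?case
      using mult_le_mono2[OF step.IH, of ?r] by (simp add: mult.assoc)
  qed
  then show ?thesis
    using card_words_of_length_ge[OF assms(1,2), of l] by linarith
qed

text \<open>Inversion permutes the reduced words of length \<open>l\<close> and exchanges this
  condition with the one on prefixes.\<close>

lemma card_words_with_inverse_prefix:
  assumes "finite S" "S \<noteq> {}" "0 < m" "m \<le> l"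
  shows "card {w \<in> words_of_length S l. take m (inverse_word w) = s} * (2 * card S - 1) ^ m
    \<le> card (words_of_length S l)"
proof -
  have "{w \<in> words_of_length S l. take m (inverse_word w) = s}
      = inverse_word ` {w \<in> words_of_length S l. take m w = s}"
  proof (intro equalityI subsetI)
    fix w assume "w \<in> {w \<in> words_of_length S l. take m (inverse_word w) = s}"
    then show "w \<in> inverse_word ` {w \<in> words_of_length S l. take m w = s}"
      by (intro image_eqI[of _ _ "inverse_word w"]) (auto simp: inverse_word_in_words_of_length)
  qed (auto simp: inverse_word_in_words_of_length)
  moreover have "inj_on inverse_word A" for A :: "'a word set"
    by (metis inj_onI inverse_word_inverse_word)
  ultimately show ?thesis
    using card_words_with_prefix[OF assms] by (simp only: card_image)
qed

text \<open>The last \<open>m\<close> letters are then the inverse of the first \<open>m\<close>. As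
  \<open>2 * m \<le> l\<close>, the two segments do not overlap, so the first \<open>l - m\<close>
  letters determine the word. The factor 2 comes from the upper bound on the number of words of
  length \<open>l - m\<close>.\<close>

lemma card_words_with_equal_ends:
  assumes "finite S" "S \<noteq> {}" "2 * m \<le> l"
  shows "card {w \<in> words_of_length S l. take m w = take m (inverse_word w)} * (2 * card S - 1) ^ m
    \<le> 2 * card (words_of_length S l)"
proof -
  let ?r = "2 * card S - 1"
  let ?A = "{w \<in> words_of_length S l. take m w = take m (inverse_word w)}"
  have decomp: "w = take (l - m) w @ inverse_word (take m (take (l - m) w))" if "w \<in> ?A" for w
  proof -
    have len: "length w = l" using that by (simp add: words_of_length_def)
    have "take m (inverse_word w) = inverse_word (drop (l - m) w)"
      using len assms(3) by (simp add: inverse_word_def take_rev drop_map)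
    then have "drop (l - m) w = inverse_word (take m w)"
      using that by simp
    then show ?thesis
      using assms(3) by (metis (no_types, lifting) append_take_drop_id le_diff_conv2 min.absorb1
        mult_2 take_take add_leD2)
  qed
  have "inj_on (take (l - m)) ?A"
    using decomp by (metis (no_types, lifting) inj_onI)
  moreover have "take (l - m) ` ?A \<subseteq> words_of_length S (l - m)"
    by (auto simp: words_of_length_def dest: in_set_takeD)
      (metis append_take_drop_id reduced_words_append_iff)
  ultimately have "card ?A \<le> card (words_of_length S (l - m))"
    using assms finite_words_of_length by (meson card_inj_on_le)
  also have "\<dots> \<le> 2 * ?r ^ (l - m)"
    by (rule card_words_of_length_le[OF assms(1,2)])
  finally have "card ?A * ?r ^ m \<le> 2 * ?r ^ (l - m) * ?r ^ m"
    by (rule mult_le_mono1)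
  also have "\<dots> = 2 * ?r ^ l"
    using assms by (simp add: mult.assoc flip: power_add)
  finally show ?thesis
    using card_words_of_length_ge[OF assms(1,2), of l] by linarith
qed

text \<open>The bad event for a single entry of a tuple, with \<open>A\<close> intended to be the
  set of end prefixes of all other entries.\<close>

definition has_end_in :: "nat \<Rightarrow> 'a word set \<Rightarrow> 'a word \<Rightarrow> bool" where
  "has_end_in m A w \<longleftrightarrow> take m w = take m (inverse_word w) \<or> end_prefixes m w \<inter> A \<noteq> {}"

text \<open>Union bound: matching ends contribute 2, and every element of \<open>A\<close>
  contributes 1 for each of the two ends of the word.\<close>

lemma card_words_of_length_has_end_in:
  assumes "finite S" "S \<noteq> {}" "0 < m" "2 * m \<le> l" "finite A"
  shows "card {w \<in> words_of_length S l. has_end_in m A w} * (2 * card S - 1) ^ m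
    \<le> (2 + 2 * card A) * card (words_of_length S l)"
proof -
  let ?W = "words_of_length S l"
  let ?c = "\<lambda>P. card {w \<in> ?W. P w}"
  let ?r = "(2 * card S - 1) ^ m"
  have fin: "finite ?W"
    using assms by (simp add: finite_words_of_length)
  have "{w \<in> ?W. has_end_in m A w} = {w \<in> ?W. take m w = take m (inverse_word w)} \<union>
      (\<Union>s\<in>A. {w \<in> ?W. take m w = s} \<union> {w \<in> ?W. take m (inverse_word w) = s})"
    by (auto simp: has_end_in_def end_prefixes_def)
  then have "?c (has_end_in m A) \<le> ?c (\<lambda>w. take m w = take m (inverse_word w)) +
      card (\<Union>s\<in>A. {w \<in> ?W. take m w = s} \<union> {w \<in> ?W. take m (inverse_word w) = s})"
    by (simp add: card_Un_le)
  also have "\<dots> \<le> ?c (\<lambda>w. take m w = take m (inverse_word w)) +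
      (\<Sum>s\<in>A. ?c (\<lambda>w. take m w = s) + ?c (\<lambda>w. take m (inverse_word w) = s))"
    by (intro add_left_mono order_trans[OF card_UN_le[OF \<open>finite A\<close>]] sum_mono card_Un_le)
  finally have "?c (has_end_in m A) * ?r \<le> (?c (\<lambda>w. take m w = take m (inverse_word w)) +
      (\<Sum>s\<in>A. ?c (\<lambda>w. take m w = s) + ?c (\<lambda>w. take m (inverse_word w) = s))) * ?r"
    by (rule mult_le_mono1)
  also have "\<dots> = ?c (\<lambda>w. take m w = take m (inverse_word w)) * ?r +
      (\<Sum>s\<in>A. ?c (\<lambda>w. take m w = s) * ?r + ?c (\<lambda>w. take m (inverse_word w) = s) * ?r)"
    by (simp only: add_mult_distrib sum_distrib_right)
  also have "\<dots> \<le> 2 * card ?W + (\<Sum>s\<in>A. card ?W + card ?W)"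
    using assms by (intro add_mono sum_mono card_words_with_equal_ends card_words_with_prefix
      card_words_with_inverse_prefix) auto
  finally show ?thesis
    by (simp add: algebra_simps)
qed

section \<open>From words of one length to balls\<close>

lemma words_up_to_eq_UN: "words_up_to S p = (\<Union>l\<le>p. words_of_length S l)"
  by (auto simp: words_up_to_def words_of_length_def)

lemma card_words_up_to_filter:
  assumes "finite S"
  shows "card {w \<in> words_up_to S p. P w} = (\<Sum>l\<le>p. card {w \<in> words_of_length S l. P w})"
proof -
  have "{w \<in> words_up_to S p. P w} = (\<Union>l\<le>p. {w \<in> words_of_length S l. P w})"
    by (auto simp: words_up_to_eq_UN)
  then show ?thesis
    using finite_words_of_length[OF assms]
    by (simp only:) (rule card_UN_disjoint, simp_all, auto simp: words_of_length_def)
qed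

text \<open>There is a reduced word of every length. This crude growth suffices to make any fixed
  number of short words negligible in large balls.\<close>

lemma card_words_up_to_ge:
  assumes "finite S" "S \<noteq> {}"
  shows "p \<le> card (words_up_to S p)"
proof -
  have "1 \<le> card (words_of_length S l)" for l
  proof -
    have "0 < card S" using assms by (simp add: card_gt_0_iff)
    then have "1 \<le> (2 * card S - 1) ^ l" by (intro one_le_power) linarith
    then show ?thesis using card_words_of_length_ge[OF assms, of l] by linarith
  qed
  then have "(\<Sum>l\<le>p. 1) \<le> (\<Sum>l\<le>p. card (words_of_length S l))"
    by (intro sum_mono)
  then show ?thesis
    using card_words_up_to_filter[OF assms(1), of p "\<lambda>_. True"] by simp
qed

text \<open>The bounds for the single lengths are added up. They hold from length
  \<open>2 * m\<close> on, so shorter words are left out of the event and are counted separately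
  later.\<close>

lemma card_words_up_to_has_end_in:
  assumes "finite S" "S \<noteq> {}" "0 < m" "finite A"
  shows "card {w \<in> words_up_to S p. 2 * m \<le> length w \<and> has_end_in m A w} * (2 * card S - 1) ^ m
    \<le> (2 + 2 * card A) * card (words_up_to S p)"
proof -
  let ?r = "(2 * card S - 1) ^ m"
  have "card {w \<in> words_of_length S l. 2 * m \<le> length w \<and> has_end_in m A w} * ?r
      \<le> (2 + 2 * card A) * card (words_of_length S l)" for l
  proof (cases "2 * m \<le> l")
    case True
    then have "{w \<in> words_of_length S l. 2 * m \<le> length w \<and> has_end_in m A w}
        = {w \<in> words_of_length S l. has_end_in m A w}"
      by (auto simp: words_of_length_def)
    then show ?thesis
      using card_words_of_length_has_end_in[OF assms(1-3) True assms(4)] by simp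
  next
    case False
    then have "{w \<in> words_of_length S l. 2 * m \<le> length w \<and> has_end_in m A w} = {}"
      by (auto simp: words_of_length_def)
    then show ?thesis by (simp only: card.empty mult_0 le0)
  qed
  then have "(\<Sum>l\<le>p. card {w \<in> words_of_length S l. 2 * m \<le> length w \<and> has_end_in m A w} * ?r)
      \<le> (\<Sum>l\<le>p. (2 + 2 * card A) * card (words_of_length S l))"
    by (intro sum_mono)
  then show ?thesis
    using card_words_up_to_filter[OF assms(1), of p "\<lambda>_. True"]
    by (simp add: card_words_up_to_filter[OF assms(1)] sum_distrib_left sum_distrib_right)
qed

subsection \<open>Density\<close>

text \<open>Splitting a tuple into its \<open>j\<close>-th entry and the rest is injective, so
  tuples are counted fibre by fibre over the rest. \<open>R\<close> takes the rest as an argument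
  because the bad event for one entry depends on the others.\<close>

lemma card_PiE_fibre_le:
  fixes K :: real
  assumes "finite I" "j \<in> I" "finite B"
    and K: "\<And>g. g \<in> (I - {j}) \<rightarrow>\<^sub>E B \<Longrightarrow> card {y \<in> B. R g y} \<le> K"
  shows "card {f \<in> I \<rightarrow>\<^sub>E B. R (restrict f (I - {j})) (f j)} \<le> card B ^ (card I - 1) * K"
proof -
  let ?F = "{f \<in> I \<rightarrow>\<^sub>E B. R (restrict f (I - {j})) (f j)}"
  let ?G = "(I - {j}) \<rightarrow>\<^sub>E B"
  let ?\<Phi> = "\<lambda>f. (restrict f (I - {j}), f j)"
  have "inj_on ?\<Phi> ?F"
  proof (rule inj_onI)
    fix f f' assume f: "f \<in> ?F" "f' \<in> ?F" and eq: "?\<Phi> f = ?\<Phi> f'"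
    show "f = f'"
    proof (rule PiE_ext[of f I "\<lambda>_. B"])
      fix i assume "i \<in> I"
      have "restrict f (I - {j}) i = restrict f' (I - {j}) i" "f j = f' j"
        using eq by (metis prod.inject)+
      then show "f i = f' i"
        using \<open>i \<in> I\<close> by (cases "i = j") simp_all
    qed (use f in simp_all)
  qed
  moreover have "?\<Phi> ` ?F \<subseteq> (SIGMA g:?G. {y \<in> B. R g y})"
  proof (rule image_subsetI)
    fix f assume f: "f \<in> ?F"
    then have "restrict f (I - {j}) \<in> ?G"
      by (auto simp only: restrict_PiE_iff mem_Collect_eq intro: PiE_mem)
    moreover have "f j \<in> B"
      using f \<open>j \<in> I\<close> by (auto intro: PiE_mem)
    ultimately show "?\<Phi> f \<in> (SIGMA g:?G. {y \<in> B. R g y})"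
      using f by blast
  qed
  moreover have fin: "finite ?G"
    using assms by (intro finite_PiE) auto
  moreover from fin have "finite (SIGMA g:?G. {y \<in> B. R g y})"
    using assms by (intro finite_SigmaI) auto
  ultimately have "card ?F \<le> card (SIGMA g:?G. {y \<in> B. R g y})"
    by (meson card_inj_on_le)
  also have "\<dots> = (\<Sum>g\<in>?G. card {y \<in> B. R g y})"
    using fin assms by (intro card_SigmaI) auto
  finally have "real (card ?F) \<le> (\<Sum>g\<in>?G. real (card {y \<in> B. R g y}))"
    by (simp flip: of_nat_sum)
  also have "\<dots> \<le> (\<Sum>g\<in>?G. K)"
    by (intro sum_mono K)
  also have "\<dots> = card B ^ (card I - 1) * K"
    using assms by (simp add: card_PiE)
  finally show ?thesis .
qed

section \<open>Tuples of group elements counted through their reduced words\<close>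

lemma reduced_word_bij_betw_ball:
  assumes "free_basis H Y"
  shows "bij_betw (reduced_word H Y) (word_ball H Y p) (words_up_to Y p)"
proof (rule bij_betw_byWitness[of _ "word_val H"])
  show "word_val H ` words_up_to Y p \<subseteq> word_ball H Y p"
    by (auto simp: words_up_to_def word_ball_def word_length_def reduced_word_word_val[OF assms]
      word_val_in_carrier[OF assms])
qed (auto simp: word_ball_def words_up_to_def word_length_def reduced_word_word_val[OF assms]
    word_val_reduced_word[OF assms] reduced_word_in_reduced_words[OF assms])

lemma card_word_ball_filter:
  assumes "free_basis H Y"
  shows "card {g \<in> word_ball H Y p. P (reduced_word H Y g)} = card {w \<in> words_up_to Y p. P w}"
proof (rule bij_betw_same_card)
  show "bij_betw (reduced_word H Y) {g \<in> word_ball H Y p. P (reduced_word H Y g)}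
      {w \<in> words_up_to Y p. P w}"
    using reduced_word_bij_betw_ball[OF assms, of p]
    by (auto simp: bij_betw_def intro: inj_on_subset)
qed

text \<open>\<open>c\<close> will bound the lengths of the words \<psi>(a_i): after \<open>m\<close>
  letters are removed at both ends of an entry, more than \<open>c\<close> letters must
  remain.\<close>

definition good_tuple ::
    "('b, 'd) monoid_scheme \<Rightarrow> 'b set \<Rightarrow> nat \<Rightarrow> nat \<Rightarrow> nat \<Rightarrow> (nat \<Rightarrow> 'b) \<Rightarrow> bool" where
  "good_tuple H Y n m c h \<longleftrightarrow> (\<forall>i<n.
     2 * m + c < length (reduced_word H Y (h i)) \<and>
     \<not> has_end_in m (\<Union>j\<in>{..<n} - {i}. end_prefixes m (reduced_word H Y (h j)))
        (reduced_word H Y (h i)))"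

lemma good_tuple_remnant:
  assumes free: "free_basis H Y" and h: "h \<in> {..<n} \<rightarrow> carrier H" and "0 < m"
    and good: "good_tuple H Y n m c h"
  shows "has_remnant H Y n h" and "\<And>i. i < n \<Longrightarrow> c < length (remnant H Y n h i)"
proof -
  have "\<exists>v. noncancelling_subword H Y n h i v \<and> c < length v" if "i < n" for i
  proof -
    have len: "2 * m + c < length (reduced_word H Y (h i))"
      using good \<open>i < n\<close> by (simp add: good_tuple_def)
    have "2 * m < length (reduced_word H Y (h i))"
      using len by simp
    moreover have "take m (reduced_word H Y (h j)) \<noteq> take m (inverse_word (reduced_word H Y (h j)))"
      if "j < n" for j
      using good that by (auto simp: good_tuple_def has_end_in_def)
    moreover have "end_prefixes m (reduced_word H Y (h i)) \<inter>
        end_prefixes m (reduced_word H Y (h j)) = {}" if "j < n" "j \<noteq> i" for j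
      using good that \<open>i < n\<close> unfolding good_tuple_def has_end_in_def by blast
    ultimately obtain v where "noncancelling_subword H Y n h i v"
        "length v = length (reduced_word H Y (h i)) - 2 * m"
      using noncancelling_subword_middle[OF free h \<open>i < n\<close> \<open>0 < m\<close>] by metis
    then show ?thesis
      using len by (intro exI[of _ v]) simp
  qed
  then show "has_remnant H Y n h" "\<And>i. i < n \<Longrightarrow> c < length (remnant H Y n h i)"
    unfolding has_remnant_def
    using noncancelling_subword_length_le_remnant by (blast, meson order_less_le_trans)
qed

text \<open>A tuple that is not good has a bad entry, whence the factor \<open>n\<close>. With the
  other entries fixed, this entry is either short, which leaves a number of choices independent of
  \<open>p\<close>, or has an end among at most \<open>2 * (n - 1)\<close> prefixes, which leaves a
  proportion of at most \<delta>.\<close>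

lemma card_not_good_tuple_le:
  fixes \<delta> :: real
  assumes free: "free_basis H Y" and "finite Y"
    and \<delta>: "\<And>A. finite A \<Longrightarrow> card A \<le> 2 * (n - 1) \<Longrightarrow>
      card {w \<in> words_up_to Y p. 2 * m \<le> length w \<and> has_end_in m A w} \<le> \<delta> * card (words_up_to Y p)"
  shows "card {h \<in> {..<n} \<rightarrow>\<^sub>E word_ball H Y p. \<not> good_tuple H Y n m c h}
    \<le> n * (card (word_ball H Y p) ^ (n - 1) *
        (card (words_up_to Y (2 * m + c)) + \<delta> * card (word_ball H Y p)))"
proof -
  let ?rw = "reduced_word H Y"
  let ?B = "word_ball H Y p"
  let ?A = "\<lambda>j g. \<Union>i\<in>{..<n} - {j}. end_prefixes m (?rw (g i))"
  \<comment> \<open>The lower bound on the length in the second alternative loses nothing: words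
    that miss the first alternative are longer than \<open>2 * m + c\<close>.\<close>
  define R where "R j g y \<longleftrightarrow> length (?rw y) \<le> 2 * m + c \<or>
    2 * m \<le> length (?rw y) \<and> has_end_in m (?A j g) (?rw y)" for j g y
  let ?K = "card (words_up_to Y (2 * m + c)) + \<delta> * card ?B"
  have cardB: "card ?B = card (words_up_to Y p)"
    using card_word_ball_filter[OF free, of p "\<lambda>_. True"] by simp
  have finB: "finite ?B"
    using reduced_word_bij_betw_ball[OF free] finite_words_up_to[OF \<open>finite Y\<close>]
    by (metis bij_betw_finite)
  have fibre: "card {y \<in> ?B. R j g y} \<le> ?K" if "j < n" for j g
  proof -
    have "card (?A j g) \<le> (\<Sum>i\<in>{..<n} - {j}. card (end_prefixes m (?rw (g i))))"
      by (rule card_UN_le) simp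
    also have "\<dots> \<le> (\<Sum>i\<in>{..<n} - {j}. 2)"
      by (intro sum_mono) (simp add: end_prefixes_def card_insert_if)
    also have "\<dots> = 2 * (n - 1)"
      using that by simp
    finally have A: "card (?A j g) \<le> 2 * (n - 1)" .
    have "{w \<in> words_up_to Y p. length w \<le> 2 * m + c} \<subseteq> words_up_to Y (2 * m + c)"
      by (auto simp: words_up_to_def)
    then have short: "card {w \<in> words_up_to Y p. length w \<le> 2 * m + c} \<le> card (words_up_to Y (2 * m + c))"
      using finite_words_up_to[OF \<open>finite Y\<close>] by (rule card_mono[rotated])
    have "card {y \<in> ?B. R j g y} = card {w \<in> words_up_to Y p. length w \<le> 2 * m + c \<or>
        2 * m \<le> length w \<and> has_end_in m (?A j g) w}"
      unfolding R_def by (rule card_word_ball_filter[OF free])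
    also have "\<dots> = card ({w \<in> words_up_to Y p. length w \<le> 2 * m + c} \<union>
        {w \<in> words_up_to Y p. 2 * m \<le> length w \<and> has_end_in m (?A j g) w})"
      by (rule arg_cong[of _ _ card]) auto
    also have "\<dots> \<le> card {w \<in> words_up_to Y p. length w \<le> 2 * m + c} +
        card {w \<in> words_up_to Y p. 2 * m \<le> length w \<and> has_end_in m (?A j g) w}"
      by (rule card_Un_le)
    finally have "real (card {y \<in> ?B. R j g y}) \<le>
        card {w \<in> words_up_to Y p. length w \<le> 2 * m + c} +
        real (card {w \<in> words_up_to Y p. 2 * m \<le> length w \<and> has_end_in m (?A j g) w})"
      by linarith
    also have "\<dots> \<le> ?K"
      unfolding cardB using short A by (intro add_mono \<delta>) (auto simp: end_prefixes_def)
    finally show ?thesis .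
  qed
  have "{h \<in> {..<n} \<rightarrow>\<^sub>E ?B. \<not> good_tuple H Y n m c h} \<subseteq>
      (\<Union>j<n. {h \<in> {..<n} \<rightarrow>\<^sub>E ?B. R j (restrict h ({..<n} - {j})) (h j)})"
  proof
    fix h assume "h \<in> {h \<in> {..<n} \<rightarrow>\<^sub>E ?B. \<not> good_tuple H Y n m c h}"
    then obtain j where j: "h \<in> {..<n} \<rightarrow>\<^sub>E ?B" "j < n"
        "length (?rw (h j)) \<le> 2 * m + c \<or> has_end_in m (?A j h) (?rw (h j))"
      by (force simp: good_tuple_def not_less)
    \<comment> \<open>The fibre count sees only the entries other than the \<open>j\<close>-th, and
      these are the only ones that the set of forbidden prefixes uses.\<close>
    have "?A j (restrict h ({..<n} - {j})) = ?A j h"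
      by auto
    then have "R j (restrict h ({..<n} - {j})) (h j)"
      using j(3) unfolding R_def
      by (cases "length (?rw (h j)) \<le> 2 * m + c") simp_all
    then show "h \<in> (\<Union>j<n. {h \<in> {..<n} \<rightarrow>\<^sub>E ?B. R j (restrict h ({..<n} - {j})) (h j)})"
      using j by blast
  qed
  then have "card {h \<in> {..<n} \<rightarrow>\<^sub>E ?B. \<not> good_tuple H Y n m c h} \<le>
      card (\<Union>j<n. {h \<in> {..<n} \<rightarrow>\<^sub>E ?B. R j (restrict h ({..<n} - {j})) (h j)})"
    using finB by (intro card_mono finite_UN_I) (auto intro: finite_subset[OF _ finite_PiE[of "{..<n}" "\<lambda>_. ?B"]])
  also have "\<dots> \<le> (\<Sum>j<n. card {h \<in> {..<n} \<rightarrow>\<^sub>E ?B. R j (restrict h ({..<n} - {j})) (h j)})"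
    by (rule card_UN_le) simp
  finally have "real (card {h \<in> {..<n} \<rightarrow>\<^sub>E ?B. \<not> good_tuple H Y n m c h}) \<le>
      (\<Sum>j<n. real (card {h \<in> {..<n} \<rightarrow>\<^sub>E ?B. R j (restrict h ({..<n} - {j})) (h j)}))"
    by (simp flip: of_nat_sum)
  also have "\<dots> \<le> (\<Sum>j<n. card ?B ^ (n - 1) * ?K)"
    using finB card_PiE_fibre_le[of "{..<n}" _ ?B "R _" ?K] fibre by (intro sum_mono) auto
  finally show ?thesis
    by (simp add: algebra_simps)
qed

text \<open>Order of choices: \<epsilon> determines \<delta>, then \<delta> determines
  \<open>m\<close>, and only then \<open>p\<close> tends to infinity. The proportion of tuples that
  are not good is at most \<open>n * (N / card (?B p) + \<delta>)\<close> with \<open>N\<close>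
  independent of \<open>p\<close>.\<close>

lemma generic_if_good_tuples:
  assumes free: "free_basis H Y" and "finite Y" and "Y \<noteq> {}"
    and T: "\<And>m h. 0 < m \<Longrightarrow> h \<in> {..<n} \<rightarrow>\<^sub>E carrier H \<Longrightarrow> good_tuple H Y n m c h \<Longrightarrow> h \<in> T"
    and rare: "\<And>\<delta>::real. 0 < \<delta> \<Longrightarrow> \<exists>m>0. \<forall>p A. finite A \<longrightarrow> card A \<le> 2 * (n - 1) \<longrightarrow>
      card {w \<in> words_up_to Y p. 2 * m \<le> length w \<and> has_end_in m A w} \<le> \<delta> * card (words_up_to Y p)"
  shows "generic H Y n T"
proof -
  let ?B = "word_ball H Y"
  let ?P = "\<lambda>p. {..<n} \<rightarrow>\<^sub>E ?B p"
  let ?ratio = "\<lambda>p. real (card (T \<inter> ?P p)) / real (card (?P p))"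
  have finB: "finite (?B p)" for p
    using reduced_word_bij_betw_ball[OF free] finite_words_up_to[OF \<open>finite Y\<close>]
    by (metis bij_betw_finite)
  then have finP: "finite (?P p)" for p
    by (intro finite_PiE) auto
  have cardB: "card (?B p) = card (words_up_to Y p)" for p
    using card_word_ball_filter[OF free, of p "\<lambda>_. True"] by simp
  have "real k / real l \<le> 1" if "k \<le> l" for k l :: nat
    using that by (auto simp: divide_le_eq_1)
  moreover have "card (T \<inter> ?P p) \<le> card (?P p)" for p
    by (intro card_mono finP Int_lower2)
  ultimately have le1: "?ratio p \<le> 1" for p
    by blast
  have "filterlim (\<lambda>p. real (card (?B p))) at_top sequentially"
    using card_words_up_to_ge[OF \<open>finite Y\<close> \<open>Y \<noteq> {}\<close>]
    by (intro filterlim_at_top_mono[OF filterlim_real_sequentially]) (auto simp: cardB)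
  then have lim0: "(\<lambda>p. x / real (card (?B p))) \<longlonglongrightarrow> 0" for x
    by (intro tendsto_divide_0[OF tendsto_const] filterlim_at_top_imp_at_infinity)
  have "\<forall>\<^sub>F p in sequentially. dist (?ratio p) 1 < \<epsilon>" if "0 < \<epsilon>" for \<epsilon> :: real
  proof -
    \<comment> \<open>Short entries and coinciding ends will each cost at most \<delta> per
      coordinate. Using \<open>Suc n\<close> makes the final inequality strict and covers
      \<open>n = 0\<close>.\<close>
    define \<delta> where "\<delta> = \<epsilon> / real (2 * Suc n)"
    have \<delta>: "real (2 * Suc n) * \<delta> = \<epsilon>"
      by (simp add: \<delta>_def del: of_nat_Suc of_nat_mult)
    have "0 < \<delta>"
      using that by (simp add: \<delta>_def del: of_nat_Suc)
    then obtain m where "0 < m" and m: "\<And>p A. finite A \<Longrightarrow> card A \<le> 2 * (n - 1) \<Longrightarrow>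
        card {w \<in> words_up_to Y p. 2 * m \<le> length w \<and> has_end_in m A w} \<le> \<delta> * card (words_up_to Y p)"
      using rare[of \<delta>] by blast
    define N where "N = real (card (words_up_to Y (2 * m + c)))"
    have "\<forall>\<^sub>F p in sequentially. N / real (card (?B p)) < \<delta>"
      using order_tendstoD(2)[OF lim0 \<open>0 < \<delta>\<close>] .
    then show ?thesis
      using eventually_gt_at_top[of 0]
    proof eventually_elim
      case (elim p)
      let ?b = "real (card (?B p))"
      have b: "0 < ?b"
        using card_words_up_to_ge[OF \<open>finite Y\<close> \<open>Y \<noteq> {}\<close>, of p] elim(2) by (simp add: cardB)
      have cardP: "real (card (?P p)) = ?b ^ n"
        by (simp add: card_PiE)
      have "?P p - T \<subseteq> {h \<in> ?P p. \<not> good_tuple H Y n m c h}"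
        using T[OF \<open>0 < m\<close>] by (auto simp: word_ball_def PiE_iff)
      then have "card (?P p - T) \<le> card {h \<in> ?P p. \<not> good_tuple H Y n m c h}"
        using finP by (intro card_mono) auto
      then have "real (card (?P p - T)) \<le> real (card {h \<in> ?P p. \<not> good_tuple H Y n m c h})"
        by simp
      also have "\<dots> \<le> n * (?b ^ (n - 1) * (N + \<delta> * ?b))"
        using card_not_good_tuple_le[OF free \<open>finite Y\<close> m, where c = c and p = p] unfolding N_def
        by simp
      \<comment> \<open>For \<open>n = 0\<close> the exponent \<open>n - 1\<close> is truncated, but
        both sides vanish.\<close>
      also have "\<dots> = n * (N / ?b + \<delta>) * ?b ^ n"
        using b by (cases n) (simp_all add: field_simps)
      finally have "real (card (?P p - T)) / ?b ^ n \<le> n * (N / ?b + \<delta>)"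
        using b by (simp add: divide_le_eq)
      also have "\<dots> \<le> n * (\<delta> + \<delta>)"
        using elim(1) by (intro mult_left_mono) auto
      also have "\<dots> < (n + 1) * (\<delta> + \<delta>)"
        using \<open>0 < \<delta>\<close> by (intro mult_strict_right_mono) auto
      also have "\<dots> = real (2 * Suc n) * \<delta>"
        by (simp add: algebra_simps)
      also note \<delta>
      finally have "real (card (?P p - T)) / ?b ^ n < \<epsilon>" .
      moreover have "card (?P p) = card (T \<inter> ?P p) + card (?P p - T)"
        using finP[of p] by (metis Int_commute card_Int_Diff)
      then have "?ratio p = 1 - real (card (?P p - T)) / ?b ^ n"
        using b cardP by (simp add: field_simps)
      ultimately show ?case
        using le1[of p] by (simp add: dist_real_def)
    qed
  qed
  then show ?thesis
    unfolding generic_def has_asymp_density_def by (rule tendstoI)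
qed

text \<open>Over one generator the only letter that may follow a given letter is the same letter
  again, so a reduced word is a power of one letter.\<close>

lemma reduced_word_over_singleton_hd_last:
  assumes "w \<in> reduced_words {y}" "w \<noteq> []"
  shows "hd w = last w"
  using assms(2,1)
proof (induction w rule: list_nonempty_induct)
  case (cons l w)
  then show ?case
    by (cases w) (auto simp: reduced_words_def inv_letter_def)
qed simp

lemma rare_ends:
  fixes \<delta> :: real
  assumes "finite Y" and "Y \<noteq> {}" and "2 \<le> card Y \<or> n \<le> card Y" and "0 < \<delta>"
  shows "\<exists>m>0. \<forall>p A. finite A \<longrightarrow> card A \<le> 2 * (n - 1) \<longrightarrow>
    card {w \<in> words_up_to Y p. 2 * m \<le> length w \<and> has_end_in m A w} \<le> \<delta> * card (words_up_to Y p)"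
proof (cases "2 \<le> card Y")
  case True
  define r where "r = real (2 * card Y - 1)"
  have "1 < r"
    using True by (simp add: r_def)
  \<comment> \<open>\<open>2 + 4 * n\<close> dominates the factor \<open>2 + 2 * card A\<close> of
    the union bound, since \<open>card A \<le> 2 * (n - 1)\<close>.\<close>
  then have "(\<lambda>m. (2 + 4 * real n) / r ^ m) \<longlonglongrightarrow> 0"
    by (rule LIMSEQ_divide_realpow_zero)
  then have "\<forall>\<^sub>F m in sequentially. (2 + 4 * real n) / r ^ m < \<delta>"
    using order_tendstoD(2) \<open>0 < \<delta>\<close> by blast
  then have "\<forall>\<^sub>F m in sequentially. (2 + 4 * real n) / r ^ m < \<delta> \<and> 0 < m"
    using eventually_gt_at_top by (rule eventually_conj)
  then obtain m where "0 < m" and m: "(2 + 4 * real n) / r ^ m < \<delta>"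
    using eventually_happens'[OF sequentially_bot] by blast
  have "card {w \<in> words_up_to Y p. 2 * m \<le> length w \<and> has_end_in m A w} \<le> \<delta> * card (words_up_to Y p)"
    if A: "finite A" "card A \<le> 2 * (n - 1)" for p A
  proof -
    let ?k = "card {w \<in> words_up_to Y p. 2 * m \<le> length w \<and> has_end_in m A w}"
    have "real (?k * (2 * card Y - 1) ^ m) \<le> real ((2 + 2 * card A) * card (words_up_to Y p))"
      by (rule of_nat_mono, rule card_words_up_to_has_end_in[OF assms(1,2) \<open>0 < m\<close> A(1)])
    then have "?k * r ^ m \<le> (2 + 2 * real (card A)) * card (words_up_to Y p)"
      by (simp add: r_def distrib_right)
    also have "\<dots> \<le> (2 + 4 * real n) * card (words_up_to Y p)"
      using A(2) by (intro mult_right_mono) auto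
    also have "\<dots> \<le> \<delta> * r ^ m * card (words_up_to Y p)"
      using m \<open>1 < r\<close> by (intro mult_right_mono) (auto simp: divide_less_eq)
    finally have "?k * r ^ m \<le> (\<delta> * card (words_up_to Y p)) * r ^ m"
      by (simp add: mult_ac)
    then show ?thesis
      by (rule mult_right_le_imp_le) (use \<open>1 < r\<close> in simp)
  qed
  then show ?thesis
    using \<open>0 < m\<close> by blast
next
  case False
  then have "card Y = 1" "n \<le> 1"
    using assms card_gt_0_iff[of Y] by linarith+
  then obtain y where Y: "Y = {y}"
    by (auto simp: card_1_singleton_iff)
  \<comment> \<open>As \<open>n \<le> 1\<close>, the set \<open>A\<close> is empty and only matching
    ends could be bad. For \<open>m = 1\<close> they would make the first letter inverse to the
    last, whereas in a power of one letter the two are equal.\<close>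
  have "\<not> (2 * 1 \<le> length w \<and> has_end_in 1 {} w)" if "w \<in> words_up_to Y p" for w p
  proof
    assume w: "2 * 1 \<le> length w \<and> has_end_in 1 {} w"
    then have "w \<noteq> []" by auto
    then have "hd w = inv_letter (last w)"
      using w by (auto simp: has_end_in_def take_Suc hd_inverse_word)
    moreover have "hd w = last w"
      using that Y \<open>w \<noteq> []\<close> reduced_word_over_singleton_hd_last by (auto simp: words_up_to_def)
    ultimately show False
      by (metis inv_letter_def snd_conv)
  qed
  then have empty: "{w \<in> words_up_to Y p. 2 * 1 \<le> length w \<and> has_end_in 1 A w} = {}"
    if "finite A" "card A \<le> 2 * (n - 1)" for p A
    using that \<open>n \<le> 1\<close> by auto
  show ?thesis
  proof (intro exI[of _ "1::nat"] conjI allI impI)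
    fix p and A :: "'a word set"
    assume "finite A" "card A \<le> 2 * (n - 1)"
    then show "card {w \<in> words_up_to Y p. 2 * 1 \<le> length w \<and> has_end_in 1 A w}
        \<le> \<delta> * card (words_up_to Y p)"
      using \<open>0 < \<delta>\<close> by (simp only: empty) simp
  qed simp
qed

text \<open>The condition on \<open>card Y\<close> excludes exactly a trivial \<open>H\<close> with
  \<open>n > 0\<close> and an infinite cyclic \<open>H\<close> with \<open>n > 1\<close>. There no
  tuple has remnant: the empty word has no nonempty subword, and of two powers of one generator, one
  that is not the longer is swallowed by the other or its inverse.\<close>

theorem mainTheorem10:
  fixes G :: "('a, 'c) monoid_scheme" and H :: "('b, 'd) monoid_scheme"
    and a :: "nat \<Rightarrow> 'a" and n :: nat and Y :: "'b set" and \<psi> :: "'a \<Rightarrow> 'b"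
  assumes "inj_on a {..<n}" and "free_basis G (a ` {..<n})"
    and "finite Y" and "free_basis H Y"
    and "2 \<le> card Y \<or> n \<le> card Y"
    and "\<psi> \<in> hom G H"
  shows "generic H Y n
    (hom_tuple n a `
      {\<phi> \<in> hom G H.
         has_remnant H Y n (hom_tuple n a \<phi>) \<and>
         (\<forall>i<n. length (remnant H Y n (hom_tuple n a \<phi>) i) > word_length H Y (\<psi> (a i)))})"
    (is "generic H Y n ?T")
proof (cases "n = 0")
  case True
  \<comment> \<open>Without generators there is a single tuple, the everywhere undefined function,
    and \<psi> realises it, so every ratio is 1. Here \<open>Y\<close> may be empty, which the
    general argument does not allow.\<close>
  have "hom_tuple n a \<psi> \<in> ?T"
    using assms(6) True by (intro imageI) (simp add: has_remnant_def)
  moreover have "hom_tuple n a \<psi> = (\<lambda>_. undefined)"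
    by (auto simp: hom_tuple_def True)
  ultimately show ?thesis
    by (simp add: generic_def has_asymp_density_def True)
next
  case False
  then have "Y \<noteq> {}"
    using assms(5) by auto
  interpret H: group H using assms(4) by (simp add: free_basis_def)
  \<comment> \<open>The sum is a common upper bound for all the lengths \<psi> produces on the
    generators.\<close>
  define c where "c = (\<Sum>i<n. word_length H Y (\<psi> (a i)))"
  show ?thesis
  proof (rule generic_if_good_tuples[OF assms(4,3) \<open>Y \<noteq> {}\<close>])
    fix m h assume "0 < m" and h: "h \<in> {..<n} \<rightarrow>\<^sub>E carrier H" and good: "good_tuple H Y n m c h"
    \<comment> \<open>Injectivity of \<open>a\<close> lets the tuple \<open>h\<close> be read as a
      function on the basis, to which the universal property applies.\<close>
    have inv: "the_inv_into {..<n} a (a i) = i" if "i < n" for i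
      using assms(1) that by (simp add: the_inv_into_f_f)
    then have "(\<lambda>x. h (the_inv_into {..<n} a x)) \<in> a ` {..<n} \<rightarrow> carrier H"
      using h by auto
    then obtain \<phi> where \<phi>: "\<phi> \<in> hom G H"
        "\<And>x. x \<in> a ` {..<n} \<Longrightarrow> \<phi> x = h (the_inv_into {..<n} a x)"
      using free_basis_hom_exists[OF assms(2) H.group_axioms] by metis
    have tuple: "hom_tuple n a \<phi> = h"
      using h by (auto simp: hom_tuple_def \<phi>(2) inv fun_eq_iff PiE_iff extensional_def)
    have h': "h \<in> {..<n} \<rightarrow> carrier H"
      using h by auto
    note rem = good_tuple_remnant[OF assms(4) h' \<open>0 < m\<close> good]
    have "word_length H Y (\<psi> (a i)) < length (remnant H Y n h i)" if "i < n" for i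
    proof -
      have "word_length H Y (\<psi> (a i)) \<le> c"
        unfolding c_def using that by (intro member_le_sum) auto
      then show ?thesis
        using rem(2)[OF that] by linarith
    qed
    then show "h \<in> ?T"
      using \<phi>(1) rem(1) tuple by (intro image_eqI[of _ _ \<phi>]) auto
  next
    fix \<delta> :: real assume "0 < \<delta>"
    then show "\<exists>m>0. \<forall>p A. finite A \<longrightarrow> card A \<le> 2 * (n - 1) \<longrightarrow>
        card {w \<in> words_up_to Y p. 2 * m \<le> length w \<and> has_end_in m A w} \<le> \<delta> * card (words_up_to Y p)"
      by (rule rare_ends[OF assms(3) \<open>Y \<noteq> {}\<close> assms(5)])
  qed
qed

end
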